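(* Let $n$ be a positive odd integer. Then, modulo $[n]\Phi_n(q)^2$, $$\sum_{k=0}^{n-1}[8k+1]\frac{(q;q^4)_k^6(q^2;q^2)_{2k}}{(q^4;q^4)_k^6(q;q^2)_{2k}}q^{4k}\equiv\begin{cases}[n]\dfrac{(q^2;q^4)_{(n-1)/4}^2}{(q^4;q^4)_{(n-1)/4}^2}, &\text{if }n\equiv 1\pmod{4},\\[5pt] 0,&\text{if }n\equiv 3\pmod{4}.\end{cases}$$
   Context: Here $q$ is treated as an indeterminate. The $q$-shifted factorial is $(x;q)_0=1$ and $(x;q)_k=(1-x)(1-xq)\cdots(1-xq^{k-1})$ for $k\ge 1$; thus $(x;q^d)_k=\prod_{j=0}^{k-1}(1-xq^{dj})$, and $(x;q^d)_k^s$ denotes the $s$-th power of $(x;q^d)_k$. For an integer $m$, $[m]=(1-q^m)/(1-q)$ is the $q$-integer. $\Phi_n(q)=\prod_{1\le k\le n,\ \gcd(n,k)=1}(q-e^{2\pi i k/n})$ is the $n$-th cyclotomic polynomial in $q$. For rational functions $A,B$ in $q$ and a polynomial $P$ in $q$, $A\equiv B\pmod{P}$ means that the numerator of $A-B$, written in lowest terms, is divisible by $P$. *)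

theory Defs
  imports Complex_Main "HOL-Computational_Algebra.Computational_Algebra"
    "HOL-Computational_Algebra.Field_as_Ring"
begin

text \<open>
  The indeterminate q lives in the field of rational functions over the complex numbers.
  Complex coefficients are used because the cyclotomic polynomials are defined below as products
  over roots of unity.
\<close>

type_synonym ratfun = "complex poly fract"

definition q :: ratfun where
  "q = to_fract [:0, 1:]"

definition qpoch :: "ratfun \<Rightarrow> ratfun \<Rightarrow> nat \<Rightarrow> ratfun" where
  "qpoch x b k = (\<Prod>j<k. 1 - x * b ^ j)"

definition qint :: "int \<Rightarrow> ratfun" where
  "qint m = (1 - q powi m) / (1 - q)"

definition cyclotomic :: "nat \<Rightarrow> complex poly" where
  "cyclotomic n =
     (\<Prod>k\<in>{k. 1 \<le> k \<and> k \<le> n \<and> gcd n k = 1}. [:- exp (2 * complex_of_real pi * \<i> * of_nat k / of_nat n), 1:])"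

text \<open>
  The modulus is passed as a rational function that is required to be (the image of) a
  polynomial; this polynomial is unique, since \<^const>\<open>to_fract\<close> is injective.  The first component of
  \<^const>\<open>quot_of_fract\<close> is the numerator in lowest terms.
\<close>

definition qcong :: "ratfun \<Rightarrow> ratfun \<Rightarrow> ratfun \<Rightarrow> bool" where
  "qcong A B M \<longleftrightarrow> (\<exists>P. M = to_fract P \<and> P dvd fst (quot_of_fract (A - B)))"

end

theory Submission
  imports Defs "HOL-Analysis.Complex_Transcendental"
begin

text \<open>
  Put \<open>b = q^m\<close> and let \<open>S(m)\<close> be the sum in which one factor
  \<open>(q;q^4)_k^2 / (q^4;q^4)_k^2\<close> of the summand is deformed to
  \<open>(bq, q/b; q^4)_k / (bq^4, q^4/b; q^4)_k\<close>; the sum in question is \<open>S(0)\<close> (lemma \<open>summand_eq\<close>).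

  For \<open>m = 4N + 1\<close> with \<open>0 \<le> N < n\<close> the deformed series terminates inside the range of summation and
  is an instance of Jackson's very-well-poised 8-phi-7 sum, with the value
  \<open>r_N = [4N+1] (q^2;q^4)_N^2 / (q^4;q^4)_N^2\<close> (lemma \<open>jackson_sum\<close>).  On the other hand, after
  multiplication by the common denominator \<open>D = (bq^4, q^4/b; q^4)_{n-1}\<close>, the sum \<open>S\<close> becomes a
  polynomial of degree less than \<open>n\<close> in \<open>X = b + 1/b\<close>.  Its values at the \<open>n\<close> points \<open>X\<close> belonging to
  \<open>m = 1, 5, ..., 4n - 3\<close> therefore determine it, and Lagrange interpolation at \<open>m = 0\<close> gives an
  identity \<open>S(0) = (\<Sum>i<n. w_i r_i)\<close> in which every weight \<open>w_i\<close> is, up to sign, a power of \<open>q\<close> times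
  a quotient of products of factors \<open>1 - q^e\<close> (lemma \<open>sum_eq_weighted_jackson_values\<close>).

  The congruence can be read off from this identity by counting the factors that vanish at a root of
  unity \<open>z \<noteq> 1\<close> with \<open>z^n = 1\<close>.  Since \<open>n\<close> is odd, the exponents in an arithmetic progression of step 4
  and length \<open>n\<close> run once through all residues modulo \<open>n\<close>, so all counts are equal up to boundary
  terms, and \<open>w_i\<close> has order 3 at \<open>z\<close> if \<open>z^(4i+1) \<noteq> 1\<close> and order 0 otherwise
  (lemma \<open>ord_at_weight\<close>).  In the second case the factor \<open>[4i+1]\<close> of \<open>r_i\<close> contributes 1, and the
  remaining factor of \<open>r_i\<close> never has a pole (lemma \<open>sum_ind_odd_ge_even\<close>).  Hence every
  term vanishes at every \<open>z\<close>, and so does the right-hand side, which is 0 or the value \<open>r_i\<close> with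
  \<open>4i + 1 = n\<close>; this gives the congruence modulo \<open>[n]\<close>.  If \<open>z\<close> is primitive, the second case
  occurs for exactly one \<open>i < n\<close>, and all other terms vanish to order 3.  If \<open>n mod 4 = 1\<close>, the
  exceptional index has \<open>4i + 1 = n\<close>; the corresponding node agrees with the evaluation point to second
  order at \<open>z\<close>, so \<open>w_i\<close> is 1 up to order 2 (lemma \<open>weight_near_1\<close>), and the term is \<open>r_i\<close>, the
  right-hand side, up to order 3.  If \<open>n mod 4 = 3\<close>, the exceptional index has \<open>4i + 1 = 3n\<close>, and the
  factor \<open>(1 - q^(2n))^2\<close> in \<open>(q^2;q^4)_i^2\<close> raises the order of \<open>r_i\<close> to 3.
\<close>

section \<open>Powers of the indeterminate\<close>

lemma q_power: "q ^ k = to_fract (monom 1 k)"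
  by (induction k) (simp_all add: q_def monom_Suc flip: to_fract_mult)

lemma q_nonzero [simp]: "q \<noteq> 0"
  by (simp add: q_def)

lemma q_power_eq_1_iff: "q ^ k = 1 \<longleftrightarrow> k = 0"
proof -
  have "q ^ k = 1 \<longleftrightarrow> to_fract (monom 1 k :: complex poly) = to_fract 1"
    unfolding q_power to_fract_1 by (rule refl)
  also have "\<dots> \<longleftrightarrow> k = 0"
    unfolding to_fract_eq_iff by (simp add: monom_eq_1_iff)
  finally show ?thesis .
qed

text \<open>
  Integer exponents are needed because \<open>q/b\<close> with \<open>b = q^m\<close> leads to negative powers.
\<close>

definition omq :: "int \<Rightarrow> ratfun" where
  "omq e = 1 - q powi e"

lemma omq_eq_0_iff [simp]: "omq e = 0 \<longleftrightarrow> e = 0"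
proof (cases "e \<ge> 0")
  case True
  then show ?thesis
    using q_power_eq_1_iff[of "nat e"] by (auto simp: omq_def power_int_def)
next
  case False
  then show ?thesis
    using q_power_eq_1_iff[of "nat (-e)"] by (auto simp: omq_def power_int_def power_inverse)
qed

lemma omq_neq_0: "e \<noteq> 0 \<Longrightarrow> omq e \<noteq> 0"
  by simp

section \<open>A terminating case of Jackson's summation\<close>

text \<open>
  The summand without its factor \<open>(q;q^4)_k^2 / (q^4;q^4)_k^2\<close>; the function \<open>wp_ratio m\<close> is this
  factor, deformed by \<open>b = q^m\<close>.
\<close>

definition coef :: "nat \<Rightarrow> ratfun" where
  "coef k = omq (8 * int k + 1) / omq 1 * q ^ (4 * k) *
     (\<Prod>j<k. omq (4 * int j + 1) ^ 3 * omq (4 * int j + 2) /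
             (omq (4 * int j + 4) ^ 3 * omq (4 * int j + 3)))"

definition wp_ratio :: "int \<Rightarrow> nat \<Rightarrow> ratfun" where
  "wp_ratio m k = (\<Prod>j<k. omq (4 * int j + 1 + m) * omq (4 * int j + 1 - m) /
                          (omq (4 * int j + 4 + m) * omq (4 * int j + 4 - m)))"

definition jackson_value :: "nat \<Rightarrow> ratfun" where
  "jackson_value N = omq (4 * int N + 1) / omq 1 *
     (\<Prod>j<N. omq (4 * int j + 2) ^ 2 / omq (4 * int j + 4) ^ 2)"

abbreviation jackson_term :: "nat \<Rightarrow> nat \<Rightarrow> ratfun" where
  "jackson_term N k \<equiv> coef k * wp_ratio (4 * int N + 1) k"

lemma coef_Suc:
  "coef (Suc k) = coef k * (omq (8 * int k + 9) / omq (8 * int k + 1) * q ^ 4 *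
     (omq (4 * int k + 1) ^ 3 * omq (4 * int k + 2) / (omq (4 * int k + 4) ^ 3 * omq (4 * int k + 3))))"
  by (simp add: coef_def power_add divide_simps ac_simps)

lemma wp_ratio_Suc:
  "wp_ratio m (Suc k) = wp_ratio m k * (omq (4 * int k + 1 + m) * omq (4 * int k + 1 - m) /
                          (omq (4 * int k + 4 + m) * omq (4 * int k + 4 - m)))"
  by (simp add: wp_ratio_def)

text \<open>
  The Wilf-Zeilberger method compares the terms for \<open>N\<close> and \<open>N + 1\<close>, that is, \<open>b\<close> and \<open>bq^4\<close>.  The
  quotient of the two products telescopes.  It is written with \<open>N + 1\<close> on the right because the
  denominators then never vanish, even beyond the point where both series terminate.
\<close>

lemma wp_ratio_shift:
  fixes N k :: nat
  shows "wp_ratio (4 * int N + 1) k = wp_ratio (4 * int N + 5) k *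
    (omq (4 * int N + 2) * omq (4 * int k - 4 * int N - 4) * omq (4 * int k + 4 * int N + 5)
       * omq (- 4 * int N - 1)
     / (omq (4 * int k + 4 * int N + 2) * omq (- 4 * int N - 4) * omq (4 * int N + 5)
       * omq (4 * int k - 4 * int N - 1)))"
proof (induction k)
  case 0
  have "omq (4 * int N + 2) \<noteq> 0" "omq (- 4 * int N - 4) \<noteq> 0" "omq (4 * int N + 5) \<noteq> 0"
    "omq (- 4 * int N - 1) \<noteq> 0" by (simp_all; presburger)+
  then show ?case by (simp add: wp_ratio_def)
next
  case (Suc k)
  define c where "c = omq (4 * int N + 2) * omq (- 4 * int N - 1) / (omq (- 4 * int N - 4) * omq (4 * int N + 5))"
  define A where "A = wp_ratio (4 * int N + 5) k"
  have nz: "omq (4 * int k + 4 * int N + 2) \<noteq> 0" "omq (4 * int k - 4 * int N - 1) \<noteq> 0"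
    "omq (4 * int k + 4 * int N + 6) \<noteq> 0" "omq (4 * int k - 4 * int N + 3) \<noteq> 0"
    "omq (4 * int k + 4 * int N + 9) \<noteq> 0" "omq (4 * int k + 4 * int N + 5) \<noteq> 0"
    by (simp_all; presburger)+
  have IH: "wp_ratio (4 * int N + 1) k = A * c * (omq (4 * int k - 4 * int N - 4) * omq (4 * int k + 4 * int N + 5)
        / (omq (4 * int k + 4 * int N + 2) * omq (4 * int k - 4 * int N - 1)))"
    unfolding Suc.IH A_def c_def by (simp add: ac_simps)
  have "wp_ratio (4 * int N + 1) (Suc k) = A * c * (omq (4 * int k - 4 * int N - 4) * omq (4 * int k + 4 * int N + 5)
        / (omq (4 * int k + 4 * int N + 2) * omq (4 * int k - 4 * int N - 1)))
      * (omq (4 * int k + 4 * int N + 2) * omq (4 * int k - 4 * int N)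
        / (omq (4 * int k + 4 * int N + 5) * omq (4 * int k - 4 * int N + 3)))"
    unfolding wp_ratio_Suc IH by (simp add: algebra_simps)
  also have "\<dots> = A * (omq (4 * int k + 4 * int N + 6) * omq (4 * int k - 4 * int N - 4)
        / (omq (4 * int k + 4 * int N + 9) * omq (4 * int k - 4 * int N - 1)))
      * c * (omq (4 * int k - 4 * int N) * omq (4 * int k + 4 * int N + 9)
        / (omq (4 * int k + 4 * int N + 6) * omq (4 * int k - 4 * int N + 3)))"
    using nz by (simp add: divide_simps del: omq_eq_0_iff)
  also have "\<dots> = wp_ratio (4 * int N + 5) (Suc k) * c * (omq (4 * int k - 4 * int N) * omq (4 * int k + 4 * int N + 9)
        / (omq (4 * int k + 4 * int N + 6) * omq (4 * int k - 4 * int N + 3)))"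
    unfolding wp_ratio_Suc A_def by (simp add: algebra_simps)
  finally show ?case
    unfolding c_def by (simp add: algebra_simps)
qed

text \<open>
  The polynomial identity behind the telescoping, with \<open>x\<close>, \<open>K\<close>, \<open>Q\<close> in place of
  \<open>q\<close>, \<open>q^(4k)\<close>, \<open>q^(4N)\<close>.
\<close>

lemma wz_identity:
  fixes x K Q :: "'a :: field"
  shows "K * (1 - x * K^2) * ((1 - x^4 * Q)^3 * (1 - x^2 * Q * K) * (x * Q - K)
           - (1 - x^2 * Q)^3 * (x^4 * Q - K) * (1 - x^5 * Q * K)) =
         - Q * (1 + x^3 * Q) * (x * (1 - x * K)^3 * (1 - x^2 * K) * (x^4 * Q - K) * (1 - x^2 * Q * K)
           - x^3 * (1 - K)^3 * (x - K) * (1 - x^5 * Q * K) * (x * Q - K))"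
  by algebra


text \<open>
  The rational certificate.  Its factor \<open>1 - q^(4k)\<close> makes the telescoping sum start at 0, and the
  remaining factors are those forced by the poles of the quotients of consecutive terms; the constant
  is then determined by specialising \<open>k = 0\<close> in the required identity.
\<close>

definition wz_cert :: "nat \<Rightarrow> nat \<Rightarrow> ratfun" where
  "wz_cert N k = - (q powi (4 * int N + 4 - 4 * int k)) * (1 + q powi (4 * int N + 3)) *
     (omq (4 * int k) ^ 3 * omq (4 * int k - 1) * omq (4 * int k + 4 * int N + 5)) /
     (omq (8 * int k + 1) * omq (4 * int N + 4) ^ 3 * omq (4 * int k + 4 * int N + 2))"


lemma jackson_value_nonzero [simp]: "jackson_value N \<noteq> 0"
  by (simp add: jackson_value_def)

lemma jackson_value_Suc:
  "jackson_value (Suc N) = jackson_value N *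
     (omq (4 * int N + 5) / omq (4 * int N + 1) * (omq (4 * int N + 2) ^ 2 / omq (4 * int N + 4) ^ 2))"
  by (simp add: jackson_value_def divide_simps ac_simps)

context
  fixes N k :: nat and x K Q :: ratfun and F :: "nat \<Rightarrow> nat \<Rightarrow> ratfun"
  defines "x \<equiv> q" and "K \<equiv> q ^ (4 * k)" and "Q \<equiv> q ^ (4 * N)"
  defines "F \<equiv> (\<lambda>N k. jackson_term N k / jackson_value N)"
begin

lemma q_powers:
  "q powi (4 * int k) = K" "q powi (8 * int k) = K^2" "q powi (4 * int N) = Q"
proof -
  show K: "q powi (4 * int k) = K" and "q powi (4 * int N) = Q"
    unfolding K_def Q_def by (simp_all flip: power_int_of_nat)
  have "q powi (8 * int k) = (q powi (4 * int k)) ^ 2"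
    by (simp add: power2_eq_square flip: power_int_add)
  with K show "q powi (8 * int k) = K^2" by simp
qed

lemma omq_values:
  "omq (8 * int k + 1) = 1 - x * K^2" "omq (8 * int k + 9) = 1 - x^9 * K^2"
  "omq (4 * int k) = 1 - K" "omq (4 * int k + 1) = 1 - x * K" "omq (4 * int k + 2) = 1 - x^2 * K"
  "omq (4 * int k + 3) = 1 - x^3 * K" "omq (4 * int k + 4) = 1 - x^4 * K"
  "omq (4 * int k - 1) = (x - K) / x"
  "omq (4 * int N + 1) = 1 - x * Q" "omq (4 * int N + 2) = 1 - x^2 * Q"
  "omq (4 * int N + 4) = 1 - x^4 * Q" "omq (4 * int N + 5) = 1 - x^5 * Q"
  "omq (4 * int k + 4 * int N + 2) = 1 - x^2 * Q * K"
  "omq (4 * int k + 4 * int N + 5) = 1 - x^5 * Q * K"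
  "omq (4 * int k + 4 * int N + 6) = 1 - x^6 * Q * K"
  "omq (4 * int k + 4 * int N + 9) = 1 - x^9 * Q * K"
  "omq (- 4 * int N - 1) = - (1 - x * Q) / (x * Q)"
  "omq (- 4 * int N - 4) = - (1 - x^4 * Q) / (x^4 * Q)"
  "omq (4 * int k - 4 * int N - 1) = (x * Q - K) / (x * Q)"
  "omq (4 * int k - 4 * int N - 4) = (x^4 * Q - K) / (x^4 * Q)"
  "q powi (4 * int N + 4 - 4 * int k) = x^4 * Q / K" "q powi (4 * int N - 4 * int k) = Q / K" "q powi (4 * int N + 3) = x^3 * Q"
  unfolding omq_def
  by (simp_all add: power_int_add power_int_diff power_int_minus q_powers x_def divide_simps) (simp_all add: Q_def K_def)

lemma wz_nonzero:
  "x \<noteq> 0" "K \<noteq> 0" "Q \<noteq> 0"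
  "1 - x * K^2 \<noteq> 0" "1 - x^4 * Q \<noteq> 0" "1 - x^2 * Q * K \<noteq> 0" "x * Q - K \<noteq> 0" 
  "1 - x^2 * Q \<noteq> 0" "1 - x * Q \<noteq> 0" "1 - x^5 * Q \<noteq> 0"
  "1 - x^3 * K \<noteq> 0" "1 - x^4 * K \<noteq> 0" "1 - x^9 * K^2 \<noteq> 0"
  "1 - x^6 * Q * K \<noteq> 0" "1 - x^9 * Q * K \<noteq> 0"
proof -
  show nz: "x \<noteq> 0" "K \<noteq> 0" "Q \<noteq> 0" by (simp_all add: x_def K_def Q_def)
  show "1 - x * K^2 \<noteq> 0" "1 - x^4 * Q \<noteq> 0" "1 - x^2 * Q * K \<noteq> 0" 
    "1 - x^2 * Q \<noteq> 0" "1 - x * Q \<noteq> 0" "1 - x^5 * Q \<noteq> 0"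
    "1 - x^3 * K \<noteq> 0" "1 - x^4 * K \<noteq> 0" "1 - x^9 * K^2 \<noteq> 0"
    "1 - x^6 * Q * K \<noteq> 0" "1 - x^9 * Q * K \<noteq> 0"
    unfolding omq_values [symmetric] omq_eq_0_iff by presburger+
  have "omq (4 * int k - 4 * int N - 1) \<noteq> 0" unfolding omq_eq_0_iff by presburger
  then show "x * Q - K \<noteq> 0" unfolding omq_values by simp
qed

lemma wz_ratio_N:
  "F N k = F (Suc N) k * ((1 - x^2 * Q)^3 * (x^4 * Q - K) * (1 - x^5 * Q * K) /
            ((1 - x^4 * Q)^3 * (1 - x^2 * Q * K) * (x * Q - K)))"
proof -
  define A where "A = coef k * wp_ratio (4 * int N + 5) k"
  have "F (Suc N) k = A / jackson_value (Suc N)"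
    by (simp add: F_def A_def algebra_simps)
  then have 1: "F (Suc N) k = A / jackson_value N * ((1 - x * Q) * (1 - x^4 * Q)^2 / ((1 - x^5 * Q) * (1 - x^2 * Q)^2))"
    unfolding jackson_value_Suc omq_values by (simp add: divide_simps)
  have "F N k = A / jackson_value N *
     ((1 - x^2 * Q) * ((x^4 * Q - K) / (x^4 * Q)) * (1 - x^5 * Q * K) * (- (1 - x * Q) / (x * Q))
     / ((1 - x^2 * Q * K) * (- (1 - x^4 * Q) / (x^4 * Q)) * (1 - x^5 * Q) * ((x * Q - K) / (x * Q))))"
    unfolding F_def wp_ratio_shift A_def omq_values by (simp only: times_divide_eq_left mult.assoc)
  moreover have "d * (f / u) * g * (- a / v) / (h * (- b / u) * e * (i / v)) =
       a * b^2 / (e * d^2) * (d^3 * f * g / (b^3 * h * i))"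
    if "u \<noteq> 0" "v \<noteq> 0" "b \<noteq> 0" "d \<noteq> 0" for a b d e f g h i u v :: ratfun
    using that by (simp add: divide_simps power2_eq_square power3_eq_cube)
  ultimately show ?thesis
    unfolding 1 using wz_nonzero by (simp only: mult.assoc mult_eq_0_iff power_eq_0_iff simp_thms)
qed

lemma wz_cert_eq: "wz_cert N k = - (x^3) * Q * (1 + x^3 * Q) * (1 - K)^3 * (x - K) * (1 - x^5 * Q * K) /
            (K * (1 - x * K^2) * (1 - x^4 * Q)^3 * (1 - x^2 * Q * K))"
  unfolding wz_cert_def omq_values using wz_nonzero by (simp add: divide_simps eval_nat_numeral)

lemma wz_cert_Suc_eq: 
  "wz_cert N (Suc k) = - Q * (1 + x^3 * Q) * (1 - x^4 * K)^3 * (1 - x^3 * K) * (1 - x^9 * Q * K) /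
            (K * (1 - x^9 * K^2) * (1 - x^4 * Q)^3 * (1 - x^6 * Q * K))"
proof -
  have "wz_cert N (Suc k) = - (q powi (4 * int N - 4 * int k)) * (1 + q powi (4 * int N + 3)) *
     (omq (4 * int k + 4) ^ 3 * omq (4 * int k + 3) * omq (4 * int k + 4 * int N + 9)) /
     (omq (8 * int k + 9) * omq (4 * int N + 4) ^ 3 * omq (4 * int k + 4 * int N + 6))"
    by (simp add: wz_cert_def algebra_simps)
  then show ?thesis
    unfolding omq_values using wz_nonzero by (simp add: divide_simps) (simp add: ac_simps)
qed

lemma wz_ratio_k:
  "F (Suc N) (Suc k) = F (Suc N) k * 
     ((1 - x^9 * K^2) / (1 - x * K^2) * x^4 *
     ((1 - x * K) ^ 3 * (1 - x^2 * K) / ((1 - x^4 * K) ^ 3 * (1 - x^3 * K))) *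
     ((1 - x^6 * Q * K) * ((x^4 * Q - K) / (x^4 * Q)) / ((1 - x^9 * Q * K) * ((x * Q - K) / (x * Q)))))"
proof -
  have "jackson_term (Suc N) (Suc k) = jackson_term (Suc N) k *
     (omq (8 * int k + 9) / omq (8 * int k + 1) * q ^ 4 *
     (omq (4 * int k + 1) ^ 3 * omq (4 * int k + 2) / (omq (4 * int k + 4) ^ 3 * omq (4 * int k + 3))) *
     (omq (4 * int k + 4 * int N + 6) * omq (4 * int k - 4 * int N - 4)
       / (omq (4 * int k + 4 * int N + 9) * omq (4 * int k - 4 * int N - 1))))"
    by (simp add: coef_Suc wp_ratio_Suc algebra_simps)
  then show ?thesis
    unfolding F_def omq_values x_def by simp
qed

lemma wz_step:
  "F (Suc N) k - F N k = F (Suc N) (Suc k) * wz_cert N (Suc k) - F (Suc N) k * wz_cert N k"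
proof -
  define a where "a = 1 - x * K^2"
  define b where "b = (1 - x^4 * Q)^3"
  define c where "c = 1 - x^2 * Q * K"
  define d where "d = x * Q - K"
  have nz: "a \<noteq> 0" "b \<noteq> 0" "c \<noteq> 0" "d \<noteq> 0" "K \<noteq> 0"
    using wz_nonzero by (simp_all add: a_def b_def c_def d_def)
  have 1: "F N k = F (Suc N) k * ((1 - x^2 * Q)^3 * (x^4 * Q - K) * (1 - x^5 * Q * K) / (b * c * d))"
    unfolding wz_ratio_N a_def b_def c_def d_def ..
  have 2: "wz_cert N k = - (x^3) * Q * (1 + x^3 * Q) * (1 - K)^3 * (x - K) * (1 - x^5 * Q * K) / (K * a * b * c)"
    unfolding wz_cert_eq a_def b_def c_def d_def ..
  have 3: "F (Suc N) (Suc k) * wz_cert N (Suc k) = F (Suc N) k *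
            (- x * Q * (1 + x^3 * Q) * (1 - x * K)^3 * (1 - x^2 * K) * (x^4 * Q - K) / (K * a * b * d))"
    unfolding wz_ratio_k wz_cert_Suc_eq a_def b_def c_def d_def
    using wz_nonzero by (simp add: divide_simps)
  have "K * a * (b * c * d - (1 - x^2 * Q)^3 * (x^4 * Q - K) * (1 - x^5 * Q * K)) =
         - Q * (1 + x^3 * Q) * (x * (1 - x * K)^3 * (1 - x^2 * K) * (x^4 * Q - K) * c
           - x^3 * (1 - K)^3 * (x - K) * (1 - x^5 * Q * K) * d)"
    unfolding a_def b_def c_def d_def by (rule wz_identity)
  then have "1 - (1 - x^2 * Q)^3 * (x^4 * Q - K) * (1 - x^5 * Q * K) / (b * c * d) =
     - x * Q * (1 + x^3 * Q) * (1 - x * K)^3 * (1 - x^2 * K) * (x^4 * Q - K) / (K * a * b * d)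
     - (- (x^3) * Q * (1 + x^3 * Q) * (1 - K)^3 * (x - K) * (1 - x^5 * Q * K) / (K * a * b * c))"
    using nz by (simp add: divide_simps) algebra
  then have "F (Suc N) k * (1 - (1 - x^2 * Q)^3 * (x^4 * Q - K) * (1 - x^5 * Q * K) / (b * c * d)) =
     F (Suc N) k * (- x * Q * (1 + x^3 * Q) * (1 - x * K)^3 * (1 - x^2 * K) * (x^4 * Q - K) / (K * a * b * d)
     - (- (x^3) * Q * (1 + x^3 * Q) * (1 - K)^3 * (x - K) * (1 - x^5 * Q * K) / (K * a * b * c)))"
    by (rule arg_cong)
  then show ?thesis
    unfolding 1 2 3 by (simp only: right_diff_distrib mult_1_right)
qed

end

text \<open>
  Divided by the claimed value, the terms for \<open>N\<close> and \<open>N + 1\<close> differ by a telescoping difference, so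
  the normalised sum does not depend on \<open>N\<close>; for \<open>N = 0\<close> only the first term is nonzero.  The terms
  with \<open>k > N\<close> vanish, which is why the range \<open>k < n\<close> may be the same for all \<open>N < n\<close>.
\<close>

lemma jackson_sum:
  assumes "N < n"
  shows "(\<Sum>k<n. jackson_term N k) = jackson_value N"
  using assms
proof (induction N)
  case 0
  have "jackson_term 0 k = 0" if "k > 0" for k
  proof -
    have "wp_ratio 1 k = 0" unfolding wp_ratio_def using that by (intro prod_zero) auto
    then show ?thesis by simp
  qed
  then have "(\<Sum>k<n. jackson_term 0 k) = (\<Sum>k\<in>{0}. jackson_term 0 k)"
    using 0 by (intro sum.mono_neutral_right) auto
  then show ?case by (simp add: coef_def wp_ratio_def jackson_value_def)
next
  case (Suc N)
  let ?F = "\<lambda>N k. jackson_term N k / jackson_value N"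
  have "(\<Sum>k<m. ?F (Suc N) k - ?F N k) = ?F (Suc N) m * wz_cert N m" for m
  proof -
    have "(\<Sum>k<m. ?F (Suc N) k - ?F N k) =
          (\<Sum>k<m. ?F (Suc N) (Suc k) * wz_cert N (Suc k) - ?F (Suc N) k * wz_cert N k)"
      by (intro sum.cong refl wz_step)
    also have "\<dots> = ?F (Suc N) m * wz_cert N m - ?F (Suc N) 0 * wz_cert N 0"
      by (rule sum_lessThan_telescope)
    finally show ?thesis by (simp add: wz_cert_def)
  qed
  from this[of n] have "(\<Sum>k<n. ?F (Suc N) k) - (\<Sum>k<n. ?F N k) = ?F (Suc N) n * wz_cert N n"
    by (simp add: sum_subtractf)
  moreover have "wp_ratio (4 * int (Suc N) + 1) n = 0"
    unfolding wp_ratio_def using Suc.prems by (intro prod_zero bexI[of _ "Suc N"]) auto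
  moreover have "(\<Sum>k<n. ?F N k) = 1"
    using Suc by (simp flip: sum_divide_distrib)
  ultimately have "(\<Sum>k<n. ?F (Suc N) k) = 1" by simp
  then show ?case by (simp flip: sum_divide_distrib)
qed

section \<open>Interpolation in the well-poised parameter\<close>

text \<open>
  Both sides are polynomials in \<open>y\<close> of degree less than the number of nodes and agree at the nodes.
\<close>

lemma lagrange_interpolation:
  fixes p :: "'a :: field poly" and x :: "'b \<Rightarrow> 'a"
  assumes "finite I" "inj_on x I" "degree p < card I"
  shows "poly p y = (\<Sum>i\<in>I. poly p (x i) * (\<Prod>j\<in>I - {i}. (y - x j) / (x i - x j)))"
proof -
  define r where "r = (\<Sum>i\<in>I. smult (poly p (x i)) (\<Prod>j\<in>I - {i}. smult (1 / (x i - x j)) [:- x j, 1:]))"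
  have r: "poly r t = (\<Sum>i\<in>I. poly p (x i) * (\<Prod>j\<in>I - {i}. (t - x j) / (x i - x j)))" for t
    by (simp add: r_def poly_sum poly_prod diff_divide_distrib)
  have "poly p t = poly r t" if t: "t \<in> x ` I" for t
  proof -
    obtain k where k: "k \<in> I" "t = x k" using t by auto
    have "(\<Prod>j\<in>I - {i}. (t - x j) / (x i - x j)) = of_bool (i = k)" if "i \<in> I" for i
    proof (cases "i = k")
      case True
      then show ?thesis using k assms(2) by (intro trans[OF prod.neutral]) (auto dest: inj_onD)
    next
      case False
      then show ?thesis using k assms(1) by (auto intro!: prod_zero bexI[of _ k])
    qed
    then have "poly r t = (\<Sum>i\<in>I. poly p (x i) * of_bool (i = k))"
      unfolding r k(2)[symmetric] by (intro sum.cong refl) simp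
    then show ?thesis
      using k assms(1) by simp
  qed
  moreover have "degree r \<le> card I - 1"
    unfolding r_def
  proof (intro degree_sum_le assms)
    fix i assume i: "i \<in> I"
    have "degree (\<Prod>j\<in>I - {i}. smult (1 / (x i - x j)) [:- x j, 1:])
        \<le> (\<Sum>j\<in>I - {i}. 1)"
      using assms(1)
      by (intro order_trans[OF degree_prod_sum_le] sum_mono) (auto intro: order_trans[OF degree_smult_le])
    then show "degree (smult (poly p (x i)) (\<Prod>j\<in>I - {i}. smult (1 / (x i - x j)) [:- x j, 1:])) \<le> card I - 1"
      using i assms(1) by (intro order_trans[OF degree_smult_le]) simp
  qed
  ultimately have "p = r"
    using assms by (intro poly_eqI_degree[of "x ` I"]) (auto simp: card_image)
  then show ?thesis using r[of y] by simp
qed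

text \<open>
  The coordinate \<open>X = b + 1/b\<close> for \<open>b = q^m\<close>: expressions symmetric under \<open>b \<mapsto> 1/b\<close> are functions of it.
\<close>

definition node :: "int \<Rightarrow> ratfun" where
  "node m = q powi m + q powi (- m)"

lemma node_diff: "node m - node m' = q powi (- m) * omq (m + m') * omq (m - m')"
  by (simp add: node_def omq_def power_int_add power_int_diff power_int_minus field_simps)

text \<open>
  The pair of factors \<open>(1 - q^e b)(1 - q^e / b)\<close> as a linear polynomial in \<open>X = b + 1/b\<close>.
\<close>

definition lin :: "int \<Rightarrow> ratfun poly" where
  "lin e = [:1 + q powi (2 * e), - (q powi e):]"

lemma poly_lin_node: "poly (lin e) (node m) = omq (e + m) * omq (e - m)"
proof -
  have "q powi (2 * e) = q powi e * q powi e"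
    by (simp flip: power_int_add)
  then show ?thesis
    by (simp add: lin_def node_def omq_def power_int_add power_int_diff power_int_minus field_simps)
qed

lemma degree_lin_le: "degree (lin e) \<le> 1"
  by (simp add: lin_def)

lemma degree_prod_lin_le: "degree (\<Prod>j\<in>J. lin (f j)) \<le> card J"
proof (cases "finite J")
  case True
  then have "degree (\<Prod>j\<in>J. lin (f j)) \<le> (\<Sum>j\<in>J. 1)"
    by (intro order_trans[OF degree_prod_sum_le] sum_mono) (use degree_lin_le in auto)
  then show ?thesis by simp
qed simp

text \<open>
  The Lagrange coefficient for evaluation at \<open>m = 0\<close> and the node with \<open>m = 4i + 1\<close>, times the quotient
  of the values of the common denominator at these two points.
\<close>

definition weight :: "nat \<Rightarrow> nat \<Rightarrow> ratfun" where
  "weight n i =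
     (\<Prod>j\<in>{..<n} - {i}. (node 0 - node (4 * int j + 1)) / (node (4 * int i + 1) - node (4 * int j + 1))) *
     (\<Prod>j<n-1. poly (lin (4 * int j + 4)) (node (4 * int i + 1)) / poly (lin (4 * int j + 4)) (node 0))"

lemma sum_eq_weighted_jackson_values:
  assumes "n > 0"
  shows "(\<Sum>k<n. coef k * wp_ratio 0 k) = (\<Sum>i<n. weight n i * jackson_value i)"
proof -
  define x where "x i = node (4 * int i + 1)" for i
  define D where "D = (\<Prod>j<n-1. lin (4 * int j + 4))"
  \<comment> \<open>The sum with the denominator D cleared, as a polynomial in X; D cancels the denominators of every term with k < n.\<close>
  define P where "P = (\<Sum>k<n. smult (coef k)
     ((\<Prod>j<k. lin (4 * int j + 1)) * (\<Prod>j\<in>{k..<n-1}. lin (4 * int j + 4))))"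
  have D_nonzero: "poly D (node m) \<noteq> 0" if "m = 0 \<or> odd m" for m
  proof -
    have "4 * int j + 4 + m \<noteq> 0 \<and> 4 * int j + 4 - m \<noteq> 0" for j
      using that by presburger
    then show ?thesis
      by (simp add: D_def poly_prod poly_lin_node)
  qed
  have P_node: "poly P (node m) = poly D (node m) * (\<Sum>k<n. coef k * wp_ratio m k)" if m: "m = 0 \<or> odd m" for m
  proof -
    have "poly (\<Prod>j<k. lin (4 * int j + 1)) (node m) * poly (\<Prod>j\<in>{k..<n-1}. lin (4 * int j + 4)) (node m)
        = poly D (node m) * wp_ratio m k" if "k < n" for k
    proof -
      have "poly D (node m) = (\<Prod>j\<in>{..<k} \<union> {k..<n-1}. poly (lin (4 * int j + 4)) (node m))"
        unfolding D_def poly_prod using that by (intro arg_cong[of _ _ "prod _"]) auto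
      then have "poly D (node m) = poly (\<Prod>j<k. lin (4 * int j + 4)) (node m) * 
            poly (\<Prod>j\<in>{k..<n-1}. lin (4 * int j + 4)) (node m)"
        unfolding poly_prod by (subst (asm) prod.union_disjoint) auto
      moreover from this D_nonzero[OF m] have "poly (\<Prod>j<k. lin (4 * int j + 4)) (node m) \<noteq> 0"
        by auto
      moreover have "wp_ratio m k = poly (\<Prod>j<k. lin (4 * int j + 1)) (node m) / poly (\<Prod>j<k. lin (4 * int j + 4)) (node m)"
        by (simp add: wp_ratio_def poly_prod poly_lin_node prod_dividef)
      ultimately show ?thesis by simp
    qed
    then show ?thesis
      by (simp add: P_def poly_sum sum_distrib_left mult.left_commute)
  qed
  have "degree P \<le> n - 1"
    unfolding P_def
  proof (intro degree_sum_le)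
    fix k assume k: "k \<in> {..<n}"
    have "degree ((\<Prod>j<k. lin (4 * int j + 1)) * (\<Prod>j\<in>{k..<n-1}. lin (4 * int j + 4))) \<le> card {..<k} + card {k..<n-1}"
      by (intro order_trans[OF degree_mult_le] add_mono degree_prod_lin_le)
    then show "degree (smult (coef k) ((\<Prod>j<k. lin (4 * int j + 1)) * (\<Prod>j\<in>{k..<n-1}. lin (4 * int j + 4)))) \<le> n - 1"
      using k by (intro order_trans[OF degree_smult_le]) auto
  qed simp
  moreover have "inj_on x {..<n}"
  proof (rule inj_onI)
    fix i j assume "x i = x j"
    then have "omq (4 * int i + 1 + (4 * int j + 1)) * omq (4 * int i + 1 - (4 * int j + 1)) = 0"
      using node_diff[of "4 * int i + 1" "4 * int j + 1"] by (simp add: x_def)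
    then show "i = j" by simp
  qed
  ultimately have "poly P (node 0) = (\<Sum>i<n. poly P (x i) * (\<Prod>j\<in>{..<n} - {i}. (node 0 - x j) / (x i - x j)))"
    using assms by (intro lagrange_interpolation) auto
  moreover have "poly P (x i) = poly D (x i) * jackson_value i" if "i < n" for i
    using that by (simp add: x_def P_node jackson_sum)
  ultimately have "poly D (node 0) * (\<Sum>k<n. coef k * wp_ratio 0 k) =
     (\<Sum>i<n. poly D (x i) * jackson_value i * (\<Prod>j\<in>{..<n} - {i}. (node 0 - x j) / (x i - x j)))"
    by (simp add: P_node)
  then have "(\<Sum>k<n. coef k * wp_ratio 0 k) =
     (\<Sum>i<n. poly D (x i) * jackson_value i * (\<Prod>j\<in>{..<n} - {i}. (node 0 - x j) / (x i - x j)) / poly D (node 0))"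
    using D_nonzero[of 0] by (simp add: field_simps flip: sum_divide_distrib)
  also have "\<dots> = (\<Sum>i<n. weight n i * jackson_value i)"
    by (intro sum.cong refl) (simp add: weight_def x_def D_def poly_prod prod_dividef)
  finally show ?thesis .
qed

section \<open>Order of vanishing of a rational function\<close>

definition ord_at :: "complex \<Rightarrow> ratfun \<Rightarrow> int" where
  "ord_at z A = int (order z (fst (quot_of_fract A))) - int (order z (snd (quot_of_fract A)))"

lemma ratfun_eq_quotient: "A = to_fract (fst (quot_of_fract A)) / to_fract (snd (quot_of_fract A))" for A :: ratfun
  by (metis quot_to_fract_quot_of_fract quot_to_fract_def case_prod_unfold Fract_conv_to_fract)

lemma ratfun_cases_nonzero:
  fixes A :: ratfun
  assumes "A \<noteq> 0"
  obtains f g where "f \<noteq> 0" "g \<noteq> 0" "A = to_fract f / to_fract g"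
  using ratfun_eq_quotient[of A] assms by (metis divide_eq_0_iff to_fract_eq_0_iff)

lemma ord_at_fraction:
  assumes "f \<noteq> 0" "g \<noteq> 0"
  shows "ord_at z (to_fract f / to_fract g) = int (order z f) - int (order z g)"
proof -
  define A :: ratfun where "A = to_fract f / to_fract g"
  define a where "a = fst (quot_of_fract A)"
  define b where "b = snd (quot_of_fract A)"
  have A: "A = to_fract a / to_fract b" unfolding a_def b_def by (rule ratfun_eq_quotient)
  have "A \<noteq> 0" using assms by (simp add: A_def)
  with A have ab: "a \<noteq> 0" "b \<noteq> 0" by auto
  have "to_fract (a * g) = to_fract (f * b)"
    using A ab assms unfolding A_def to_fract_mult by (simp add: field_simps)
  then have "order z (a * g) = order z (f * b)" unfolding to_fract_eq_iff by simp
  then have "order z a + order z g = order z f + order z b"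
    using ab assms by (simp add: order_mult)
  then show ?thesis unfolding ord_at_def A_def[symmetric] a_def[symmetric] b_def[symmetric] by linarith
qed

lemma ord_at_to_fract: "f \<noteq> 0 \<Longrightarrow> ord_at z (to_fract f) = int (order z f)"
  using ord_at_fraction[of f 1] by simp

lemma ord_at_mult:
  assumes "A \<noteq> 0" "B \<noteq> 0"
  shows "ord_at z (A * B) = ord_at z A + ord_at z B"
proof -
  obtain f g where fg: "f \<noteq> 0" "g \<noteq> 0" "A = to_fract f / to_fract g" using assms ratfun_cases_nonzero by metis
  obtain h k where hk: "h \<noteq> 0" "k \<noteq> 0" "B = to_fract h / to_fract k" using assms ratfun_cases_nonzero by metis
  have "A * B = to_fract (f * h) / to_fract (g * k)" by (simp add: fg hk)
  then show ?thesis using fg hk by (simp add: ord_at_fraction order_mult del: to_fract_mult)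
qed

lemma ord_at_1 [simp]: "ord_at z 1 = 0"
  using ord_at_to_fract[of 1 z] by simp

lemma ord_at_divide:
  assumes "A \<noteq> 0" "B \<noteq> 0"
  shows "ord_at z (A / B) = ord_at z A - ord_at z B"
  using ord_at_mult[of "A / B" B z] assms by simp

lemma ord_at_power: "A \<noteq> 0 \<Longrightarrow> ord_at z (A ^ k) = int k * ord_at z A"
  by (induction k) (simp_all add: ord_at_mult algebra_simps)

lemma ord_at_power_int: "A \<noteq> 0 \<Longrightarrow> ord_at z (A powi k) = k * ord_at z A"
  by (cases k rule: int_cases2)
    (simp_all add: ord_at_power power_int_minus ord_at_divide inverse_eq_divide)

lemma ord_at_prod:
  assumes "\<And>j. j \<in> J \<Longrightarrow> f j \<noteq> 0"
  shows "ord_at z (\<Prod>j\<in>J. f j) = (\<Sum>j\<in>J. ord_at z (f j))"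
  using assms by (induction J rule: infinite_finite_induct) (simp_all add: ord_at_mult)

lemma ord_at_uminus: "ord_at z (- A) = ord_at z A"
proof (cases "A = 0")
  case False
  have "ord_at z (-1) = 0" using ord_at_to_fract[of "-1" z] by simp
  then show ?thesis using ord_at_mult[of "-1" A z] False by simp
qed simp

text \<open>
  The zero function has infinite order, whereas \<open>ord_at z 0\<close> is an arbitrary number; hence the separate
  disjunct.
\<close>

definition ord_ge :: "complex \<Rightarrow> int \<Rightarrow> ratfun \<Rightarrow> bool" where
  "ord_ge z m A \<longleftrightarrow> A = 0 \<or> m \<le> ord_at z A"

lemma ord_ge_0 [simp]: "ord_ge z m 0"
  by (simp add: ord_ge_def)

lemma ord_ge_mono: "ord_ge z m A \<Longrightarrow> m' \<le> m \<Longrightarrow> ord_ge z m' A"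
  by (auto simp: ord_ge_def)

lemma ord_ge_mult: "ord_ge z m A \<Longrightarrow> ord_ge z m' B \<Longrightarrow> ord_ge z (m + m') (A * B)"
  unfolding ord_ge_def using ord_at_mult[of A B z] by fastforce

lemma ord_ge_uminus [simp]: "ord_ge z m (- A) \<longleftrightarrow> ord_ge z m A"
  by (simp add: ord_ge_def ord_at_uminus)

lemma ord_ge_add:
  assumes "ord_ge z m A" "ord_ge z m B"
  shows "ord_ge z m (A + B)"
proof (cases "A = 0 \<or> B = 0 \<or> A + B = 0")
  case False
  then have nz: "A \<noteq> 0" "B \<noteq> 0" "A + B \<noteq> 0" by auto
  obtain f g where fg: "f \<noteq> 0" "g \<noteq> 0" "A = to_fract f / to_fract g" using nz ratfun_cases_nonzero by metis
  obtain h k where hk: "h \<noteq> 0" "k \<noteq> 0" "B = to_fract h / to_fract k" using nz ratfun_cases_nonzero by metis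
  have sum: "A + B = to_fract (f * k + h * g) / to_fract (g * k)"
    using fg hk by (simp add: field_simps)
  then have s: "f * k + h * g \<noteq> 0" using nz(3) by (metis divide_eq_0_iff to_fract_0)
  define M where "M = min (order z (f * k)) (order z (h * g))"
  have "[:- z, 1:] ^ M dvd f * k" "[:- z, 1:] ^ M dvd h * g"
    by (simp_all add: M_def order_divides)
  then have "[:- z, 1:] ^ M dvd f * k + h * g" by (rule dvd_add)
  then have "M \<le> order z (f * k + h * g)" using s by (simp add: order_divides)
  moreover have "m \<le> int (order z f) - int (order z g)" "m \<le> int (order z h) - int (order z k)"
    using assms nz fg hk by (auto simp: ord_ge_def ord_at_fraction)
  ultimately have "m \<le> int (order z (f * k + h * g)) - int (order z (g * k))"
    using fg hk by (auto simp: M_def order_mult min_def split: if_splits)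
  then show ?thesis
    unfolding ord_ge_def sum using s fg hk by (simp add: ord_at_fraction del: to_fract_mult to_fract_add)
qed (use assms in auto)

lemma ord_ge_diff: "ord_ge z m A \<Longrightarrow> ord_ge z m B \<Longrightarrow> ord_ge z m (A - B)"
  using ord_ge_add[of z m A "- B"] by simp

lemma ord_ge_sum: "(\<And>i. i \<in> I \<Longrightarrow> ord_ge z m (f i)) \<Longrightarrow> ord_ge z m (sum f I)"
  by (induction I rule: infinite_finite_induct) (simp_all add: ord_ge_add)

text \<open>
  From \<open>AB - 1 = (A - 1)(B - 1) + (A - 1) + (B - 1)\<close>: being 1 up to order \<open>m\<close> is multiplicative.
\<close>

lemma ord_ge_mult_diff_1:
  assumes "ord_ge z m (A - 1)" "ord_ge z m (B - 1)" "m \<ge> 0"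
  shows "ord_ge z m (A * B - 1)"
proof -
  have "ord_ge z (m + m) ((A - 1) * (B - 1))"
    using assms by (intro ord_ge_mult)
  then have "ord_ge z m ((A - 1) * (B - 1) + (A - 1) + (B - 1))"
    using assms by (intro ord_ge_add) (auto elim: ord_ge_mono)
  also have "(A - 1) * (B - 1) + (A - 1) + (B - 1) = A * B - 1"
    by (simp add: algebra_simps)
  finally show ?thesis .
qed

lemma ord_ge_prod_diff_1:
  assumes "\<And>j. j \<in> J \<Longrightarrow> ord_ge z m (f j - 1)" "m \<ge> 0"
  shows "ord_ge z m (prod f J - 1)"
  using assms(1)
  by (induction J rule: infinite_finite_induct) (simp_all add: ord_ge_mult_diff_1 assms(2))

text \<open>
  Over the complex numbers a polynomial splits, so divisibility can be tested root by root.
\<close>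

lemma order_complex_dvdI:
  fixes p r :: "complex poly"
  assumes "p \<noteq> 0" "r \<noteq> 0" "\<And>z. order z p \<le> order z r"
  shows "p dvd r"
  using assms
proof (induction "degree p" arbitrary: p r rule: less_induct)
  case less
  show ?case
  proof (cases "\<exists>z. poly p z = 0")
    case False
    then have "degree p = 0"
      using fundamental_theorem_of_algebra[of p] by (auto simp: constant_degree)
    then have "p dvd 1" using less.prems(1) by (simp add: is_unit_iff_degree)
    then show ?thesis by (rule dvd_trans) simp
  next
    case True
    then obtain z where z: "poly p z = 0" by blast
    then have "order z p > 0" using less.prems by (simp add: order_gt_0_iff)
    then have "order z r > 0" using less.prems(3)[of z] by linarith
    then have "poly r z = 0" using less.prems by (simp add: order_gt_0_iff)
    with z obtain p' r' where p': "p = [:- z, 1:] * p'" and r': "r = [:- z, 1:] * r'"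
      by (auto simp: poly_eq_0_iff_dvd dvd_def)
    have nz: "p' \<noteq> 0" "r' \<noteq> 0" using less.prems p' r' by auto
    have "p' dvd r'"
    proof (rule less.hyps[OF _ nz])
      have "degree p = degree [:- z, 1:] + degree p'" unfolding p' using nz by (intro degree_mult_eq) auto
      then show "degree p' < degree p" by simp
      show "order y p' \<le> order y r'" for y
        using less.prems(3)[of y] less.prems(1,2) unfolding p' r' by (simp add: order_mult del: mult_pCons_left)
    qed
    then show ?thesis unfolding p' r' by (intro mult_dvd_mono) auto
  qed
qed

text \<open>
  The order of \<open>A\<close> is at most that of its numerator, so a lower bound for the former bounds the
  multiplicity of each root of the numerator from below.
\<close>

lemma dvd_numeratorI:
  assumes "P \<noteq> 0" "\<And>z. order z P > 0 \<Longrightarrow> ord_ge z (int (order z P)) A"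
  shows "P dvd fst (quot_of_fract A)"
proof (cases "A = 0")
  case False
  have nz: "fst (quot_of_fract A) \<noteq> 0" 
    using False ratfun_eq_quotient[of A] by auto
  show ?thesis
  proof (rule order_complex_dvdI[OF assms(1) nz])
    fix z
    show "order z P \<le> order z (fst (quot_of_fract A))"
      using assms(2)[of z] False by (cases "order z P = 0") (auto simp: ord_ge_def ord_at_def)
  qed
qed simp

section \<open>Orders at the roots of unity\<close>

lemma order_one_minus_monom:
  fixes z :: complex
  assumes "k > 0"
  shows "order z (1 - monom 1 k) = of_bool (z ^ k = 1)"
proof -
  let ?p = "1 - monom 1 k :: complex poly"
  have pz: "poly ?p z = 1 - z ^ k" by (simp add: poly_monom)
  have "?p \<noteq> 0"
    using assms by (metis monom_eq_1_iff eq_iff_diff_eq_0 less_numeral_extra(3))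
  show ?thesis
  proof (cases "z ^ k = 1")
    case True
    then have "z \<noteq> 0" using assms by (auto simp: power_0_left)
    moreover have "pderiv ?p = - monom (of_nat k) (k - 1)"
      by (simp add: pderiv_diff pderiv_monom)
    ultimately have "poly (pderiv ?p) z \<noteq> 0"
      using assms by (simp add: poly_monom)
    then show ?thesis
      using order_pderiv[of ?p z] pz True \<open>?p \<noteq> 0\<close> by (simp add: order_0I)
  next
    case False
    then have "poly ?p z \<noteq> 0" unfolding pz by simp
    then show ?thesis using False by (simp add: order_0I)
  qed
qed

lemma ord_at_q: "z \<noteq> 0 \<Longrightarrow> ord_at z q = 0"
  by (simp add: q_def ord_at_to_fract order_0I)

text \<open>
  The indicator of \<open>z^e = 1\<close>, integer-valued so that it can be added up: for \<open>e \<noteq> 0\<close> it is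
  the order of \<open>1 - q^e\<close> at \<open>z\<close>, and orders of products of such factors become sums of indicators.
\<close>

definition ind :: "complex \<Rightarrow> int \<Rightarrow> int" where
  "ind z e = of_bool (z powi e = 1)"

lemma ind_uminus [simp]: "ind z (- e) = ind z e"
  by (simp add: ind_def power_int_minus)

lemma ind_0 [simp]: "ind z 0 = 1"
  by (simp add: ind_def)

lemma ind_cases: "ind z e = 0 \<or> ind z e = 1"
  by (simp add: ind_def)

lemma ord_at_omq:
  assumes "z \<noteq> 0" "e \<noteq> 0"
  shows "ord_at z (omq e) = ind z e"
proof -
  have pos: "ord_at z (omq (int k)) = ind z (int k)" if "k > 0" for k
  proof -
    have "omq (int k) = to_fract (1 - monom 1 k)"
      by (simp add: omq_def q_power)
    moreover have "1 - monom 1 k \<noteq> (0 :: complex poly)"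
      using that by (metis monom_eq_1_iff eq_iff_diff_eq_0 less_numeral_extra(3))
    ultimately show ?thesis
      using that by (simp add: ord_at_to_fract order_one_minus_monom ind_def del: to_fract_diff)
  qed
  show ?thesis
  proof (cases e rule: int_cases2)
    case (nonneg k)
    then show ?thesis using pos assms by simp
  next
    case (nonpos k)
    have "omq e = - (q powi e) * omq (int k)"
      using nonpos by (simp add: omq_def power_int_minus field_simps)
    then show ?thesis
      using pos[of k] assms nonpos by (simp add: ord_at_mult ord_at_uminus ord_at_power_int ord_at_q)
  qed
qed

text \<open>
  The right-hand side of the congruence.  For \<open>n mod 4 = 1\<close> it is the value of Jackson's sum at the
  node with \<open>b = q^n\<close> (lemma \<open>jackson_value_eq\<close>).
\<close>

definition rhs_value :: "nat \<Rightarrow> ratfun" where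
  "rhs_value n = (if n mod 4 = 1 then jackson_value ((n - 1) div 4) else 0)"

context
  fixes z :: complex and n :: nat
  assumes root: "z ^ n = 1" and z_neq_1: "z \<noteq> 1" and odd_n: "odd n"
begin

lemma z_neq_0: "z \<noteq> 0"
  using root odd_n by (cases "n = 0") (auto simp: power_0_left)

lemma n_pos: "n > 0"
  using odd_n by (cases n) auto

lemma dvd_4_mult_iff: "int n dvd 4 * e \<longleftrightarrow> int n dvd e"
proof -
  have "coprime (int n) (2 ^ 2)"
    using odd_n unfolding coprime_power_right_iff by simp
  then show ?thesis
    using coprime_dvd_mult_right_iff[of "int n" "2 ^ 2" e] by simp
qed

lemma ind_1: "ind z 1 = 0"
  using z_neq_1 by (simp add: ind_def)

lemma ind_mod: "ind z (e mod int n) = ind z e"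
proof -
  have "z powi e = z powi (int n * (e div int n) + e mod int n)" by simp
  also have "\<dots> = z powi (e mod int n)"
    unfolding power_int_add[OF disjI1[OF z_neq_0]] power_int_mult using root by simp
  finally show ?thesis by (simp add: ind_def)
qed

lemma ind_double: "ind z (2 * e) = ind z e"
proof -
  obtain r where r: "n = 2 * r + 1" using odd_n by (rule oddE)
  have "z powi e = z powi (int n * e - 2 * e * int r)"
    by (simp add: r algebra_simps)
  also have "\<dots> = (z powi int n) powi e / (z powi (2 * e)) powi int r"
    by (simp only: power_int_diff[OF disjI1[OF z_neq_0]] power_int_mult)
  finally have "z powi e = 1" if "z powi (2 * e) = 1"
    using that root by simp
  moreover have "z powi (2 * e) = (z powi e) ^ 2"
    by (simp add: power_int_mult mult.commute[of 2])
  ultimately show ?thesis by (auto simp: ind_def)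
qed

text \<open>
  As \<open>n\<close> is odd, \<open>j \<mapsto> 4j + c\<close> permutes the residues modulo \<open>n\<close>, and the indicator depends only on the
  residue.  The common value of these sums cancels in the orders computed below.
\<close>

lemma sum_ind_progression: "(\<Sum>j<n. ind z (4 * int j + c)) = (\<Sum>j<n. ind z (int j))"
proof -
  define f where "f j = nat ((4 * int j + c) mod int n)" for j
  have f: "int (f j) = (4 * int j + c) mod int n" for j
    using n_pos by (simp add: f_def)
  have "inj_on f {..<n}"
  proof (rule inj_onI)
    fix i j assume ij: "i \<in> {..<n}" "j \<in> {..<n}" "f i = f j"
    then have "(4 * int i + c) mod int n = (4 * int j + c) mod int n"
      by (simp flip: f)
    then have "int n dvd 4 * (int i - int j)"
      by (simp add: mod_eq_dvd_iff algebra_simps)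
    then have "int n dvd int i - int j"
      unfolding dvd_4_mult_iff .
    then show "i = j"
      using ij dvd_imp_le_int[of "int i - int j" "int n"] by (cases "i = j") auto
  qed
  moreover have "f ` {..<n} \<subseteq> {..<n}"
    using n_pos by (auto simp: f_def nat_less_iff)
  ultimately have "bij_betw f {..<n} {..<n}"
    by (simp add: bij_betw_def endo_inj_surj)
  then have "(\<Sum>j<n. ind z (int j)) = (\<Sum>j<n. ind z (int (f j)))"
    by (intro sum.reindex_bij_betw[symmetric])
  then show ?thesis by (simp add: f ind_mod)
qed

lemma sum_ind_progression': "(\<Sum>j<n. ind z (c - 4 * int j)) = (\<Sum>j<n. ind z (int j))"
proof -
  have "ind z (c - 4 * int j) = ind z (4 * int j + - c)" for j
    using ind_uminus[of z "c - 4 * int j"] by (simp add: algebra_simps)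
  then show ?thesis using sum_ind_progression[of "- c"] by simp
qed

text \<open>
  A progression of length \<open>n - 1\<close> is a full one without its member \<open>c\<close>.
\<close>

lemma sum_ind_shifted: "(\<Sum>j<n-1. ind z (4 * int j + 4 + c)) = (\<Sum>j<n. ind z (int j)) - ind z c"
proof -
  have "(\<Sum>j<n. ind z (int j)) = (\<Sum>j<Suc (n - 1). ind z (4 * int j + c))"
    using n_pos by (simp add: sum_ind_progression)
  then show ?thesis
    by (simp only: sum.lessThan_Suc_shift) (simp add: algebra_simps)
qed

lemma weight_factors_nonzero:
  "node 0 - node (4 * int j + 1) \<noteq> 0"
  "i \<noteq> j \<Longrightarrow> node (4 * int i + 1) - node (4 * int j + 1) \<noteq> 0"
  "poly (lin (4 * int j + 4)) (node (4 * int i + 1)) \<noteq> 0"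
  "poly (lin (4 * int j + 4)) (node 0) \<noteq> 0"
  unfolding node_diff poly_lin_node by (simp_all add: power_int_not_zero; presburger)+

lemma weight_nonzero: "weight n i \<noteq> 0"
  unfolding weight_def using weight_factors_nonzero by simp

lemma ord_at_node_diff:
  assumes "m + m' \<noteq> 0" "m - m' \<noteq> 0"
  shows "ord_at z (node m - node m') = ind z (m + m') + ind z (m - m')"
  unfolding node_diff using assms z_neq_0
  by (simp add: ord_at_mult ord_at_power_int ord_at_q ord_at_omq power_int_not_zero)

lemma ord_at_lin_node:
  assumes "e + m \<noteq> 0" "e - m \<noteq> 0"
  shows "ord_at z (poly (lin e) (node m)) = ind z (e + m) + ind z (e - m)"
  unfolding poly_lin_node using assms z_neq_0 by (simp add: ord_at_mult ord_at_omq)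

text \<open>
  Let \<open>K\<close> be the number of \<open>j < n\<close> with \<open>z^j = 1\<close>, and let \<open>e\<close> be the indicator at \<open>4i + 1\<close>.  The product over
  the other nodes has order \<open>2(K - e) - (K - e) - (K - 1) = 1 - e\<close>, and the quotient of the common
  denominators has order \<open>2(K - e) - 2(K - 1) = 2 - 2e\<close>.
\<close>

lemma ord_at_weight:
  assumes "i < n"
  shows "ord_at z (weight n i) = 3 - 3 * ind z (4 * int i + 1)"
proof -
  define e where "e = ind z (4 * int i + 1)"
  let ?a = "\<lambda>j. node 0 - node (4 * int j + 1)"
  let ?b = "\<lambda>j. node (4 * int i + 1) - node (4 * int j + 1)"
  let ?c = "\<lambda>j. poly (lin (4 * int j + 4)) (node (4 * int i + 1))"
  let ?d = "\<lambda>j. poly (lin (4 * int j + 4)) (node 0)"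
  have e': "ind z (8 * int i + 2) = e"
    using ind_double[of "4 * int i + 1"] by (simp add: e_def)
  have "ord_at z (?a j / ?b j) = 2 * ind z (4 * int j + 1) - ind z (4 * int j + (4 * int i + 2)) - ind z (4 * int i - 4 * int j)"
    if "j \<noteq> i" for j
  proof -
    have "ord_at z (?a j) = 2 * ind z (4 * int j + 1)"
      using ind_uminus[of z "4 * int j + 1"] by (subst ord_at_node_diff) (auto; presburger)+
    moreover have "ord_at z (?b j) = ind z (4 * int j + (4 * int i + 2)) + ind z (4 * int i - 4 * int j)"
      using that by (subst ord_at_node_diff) (auto simp: algebra_simps)
    ultimately show ?thesis using weight_factors_nonzero that by (simp add: ord_at_divide)
  qed
  then have "ord_at z (\<Prod>j\<in>{..<n} - {i}. ?a j / ?b j) =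
     (\<Sum>j\<in>{..<n} - {i}. 2 * ind z (4 * int j + 1) - ind z (4 * int j + (4 * int i + 2)) - ind z (4 * int i - 4 * int j))"
    using weight_factors_nonzero by (subst ord_at_prod) (auto intro!: sum.cong)
  also have "\<dots> = (\<Sum>j<n. 2 * ind z (4 * int j + 1) - ind z (4 * int j + (4 * int i + 2)) - ind z (4 * int i - 4 * int j))
       - (2 * e - e - 1)"
    using assms e' by (subst sum_diff1) (auto simp: e_def algebra_simps)
  also have "\<dots> = 1 - e"
    by (simp add: sum_subtractf sum_ind_progression sum_ind_progression' flip: sum_distrib_left)
  finally have 1: "ord_at z (\<Prod>j\<in>{..<n} - {i}. ?a j / ?b j) = 1 - e" .
  have "ord_at z (?c j / ?d j) = ind z (4 * int j + 4 + (4 * int i + 1)) + ind z (4 * int j + 4 + - (4 * int i + 1))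
      - 2 * ind z (4 * int j + 4 + 0)" for j
  proof -
    have "ord_at z (?c j) = ind z (4 * int j + 4 + (4 * int i + 1)) + ind z (4 * int j + 4 - (4 * int i + 1))"
      by (rule ord_at_lin_node) presburger+
    moreover have "ord_at z (?d j) = 2 * ind z (4 * int j + 4)"
      by (subst ord_at_lin_node) auto
    ultimately show ?thesis using weight_factors_nonzero by (simp add: ord_at_divide)
  qed
  then have "ord_at z (\<Prod>j<n-1. ?c j / ?d j) =
     (\<Sum>j<n-1. ind z (4 * int j + 4 + (4 * int i + 1)) + ind z (4 * int j + 4 + - (4 * int i + 1))
      - 2 * ind z (4 * int j + 4 + 0))"
    using weight_factors_nonzero by (subst ord_at_prod) (auto intro!: sum.cong)
  also have "\<dots> = ((\<Sum>j<n. ind z (int j)) - e) + ((\<Sum>j<n. ind z (int j)) - e) - 2 * ((\<Sum>j<n. ind z (int j)) - 1)"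
    unfolding sum_subtractf sum.distrib sum_distrib_left[symmetric] sum_ind_shifted ind_uminus ind_0 e_def ..
  finally have "ord_at z (\<Prod>j<n-1. ?c j / ?d j) = 2 - 2 * e" by simp
  moreover have "(\<Prod>j\<in>{..<n} - {i}. ?a j / ?b j) \<noteq> 0" "(\<Prod>j<n-1. ?c j / ?d j) \<noteq> 0"
    using weight_factors_nonzero by auto
  ultimately show ?thesis
    using 1 unfolding weight_def e_def[symmetric] by (simp add: ord_at_mult)
qed

lemma ord_at_jackson_value:
  "ord_at z (jackson_value N) = ind z (4 * int N + 1) +
     2 * ((\<Sum>j<N. ind z (4 * int j + 2)) - (\<Sum>j<N. ind z (4 * int j + 4)))"
proof -
  have nz: "omq (4 * int j + 2) \<noteq> 0" "omq (4 * int j + 4) \<noteq> 0" "omq (4 * int j + 1) \<noteq> 0" for j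
    by (simp_all; presburger)+
  then have "ord_at z (\<Prod>j<N. omq (4 * int j + 2) ^ 2 / omq (4 * int j + 4) ^ 2) =
      (\<Sum>j<N. 2 * ind z (4 * int j + 2) - 2 * ind z (4 * int j + 4))"
    using z_neq_0
    by (subst ord_at_prod) (auto intro!: sum.cong simp: ord_at_divide ord_at_power ord_at_omq simp del: omq_eq_0_iff)
  moreover have "(\<Prod>j<N. omq (4 * int j + 2) ^ 2 / omq (4 * int j + 4) ^ 2) \<noteq> 0"
    using nz by simp
  ultimately show ?thesis
    unfolding jackson_value_def using nz[of N] z_neq_0 ind_1
    by (simp add: ord_at_mult ord_at_divide ord_at_omq sum_subtractf right_diff_distrib flip: sum_distrib_left)
qed

text \<open>
  Orders of \<open>(q^2;q^4)_N\<close> and \<open>(q^4;q^4)_N\<close>.  Let \<open>d\<close> be the order of the root of unity \<open>z\<close>, which is odd.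
  The multiples \<open>j + 1\<close> of \<open>d\<close> are injected into the odd multiples \<open>2i + 1\<close> of \<open>d\<close> by
  \<open>2i + 1 = 2(j + 1) - d\<close>, and \<open>i \<le> j\<close>.
\<close>

lemma sum_ind_odd_ge_even:
  "(\<Sum>j<N. ind z (4 * int j + 4)) \<le> (\<Sum>j<N. ind z (4 * int j + 2))"
proof -
  define d where "d = (LEAST d. d > 0 \<and> z ^ d = 1)"
  have d: "d > 0" "z ^ d = 1"
    using LeastI[of "\<lambda>d. d > 0 \<and> z ^ d = 1" n] root n_pos unfolding d_def by blast+
  have d_dvd: "d dvd j" if "z ^ j = 1" for j
  proof -
    have "z ^ j = (z ^ d) ^ (j div d) * z ^ (j mod d)"
      by (simp flip: power_mult power_add)
    then have "z ^ (j mod d) = 1" using that d by simp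
    then have "\<not> j mod d > 0"
      using not_less_Least[of "j mod d" "\<lambda>d. d > 0 \<and> z ^ d = 1"] d(1) by (auto simp flip: d_def)
    then show ?thesis by auto
  qed
  have odd_d: "odd d" using d_dvd[OF root] odd_n by auto
  have even_ind: "ind z (4 * int j + 4) = of_bool (z ^ (j + 1) = 1)" for j
    using ind_double[of "2 * int (j + 1)"] ind_double[of "int (j + 1)"]
    by (simp add: ind_def algebra_simps flip: power_int_of_nat)
  have odd_ind: "ind z (4 * int j + 2) = of_bool (z ^ (2 * j + 1) = 1)" for j
    using ind_double[of "int (2 * j + 1)"]
    by (simp add: ind_def algebra_simps flip: power_int_of_nat)
  have "card {j\<in>{..<N}. z ^ (j + 1) = 1} \<le> card {j\<in>{..<N}. z ^ (2 * j + 1) = 1}"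
  proof (rule card_inj_on_le)
    have ge: "d \<le> j + 1" if "z ^ (j + 1) = 1" for j
      using d_dvd[OF that] by (rule dvd_imp_le) simp
    show "inj_on (\<lambda>j. j - d div 2) {j\<in>{..<N}. z ^ (j + 1) = 1}"
    proof (rule inj_onI)
      fix i j assume "i \<in> {j\<in>{..<N}. z ^ (j + 1) = 1}" "j \<in> {j\<in>{..<N}. z ^ (j + 1) = 1}" 
        and eq: "i - d div 2 = j - d div 2"
      then have "d \<le> i + 1" "d \<le> j + 1" using ge by auto
      moreover have "d div 2 \<le> d - 1" using d(1) by linarith
      ultimately show "i = j" using eq by linarith
    qed
    show "(\<lambda>j. j - d div 2) ` {j\<in>{..<N}. z ^ (j + 1) = 1} \<subseteq> {j\<in>{..<N}. z ^ (2 * j + 1) = 1}"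
    proof safe
      fix j assume j: "j < N" "z ^ (j + 1) = 1"
      obtain t where t: "d = 2 * t + 1" using odd_d by (rule oddE)
      have "2 * (j - d div 2) + 1 + d = (j + 1) * 2" using ge[OF j(2)] t by simp
      then have "z ^ (2 * (j - d div 2) + 1) * z ^ d = (z ^ (j + 1)) ^ 2"
        by (simp only: power_mult[symmetric] power_add[symmetric])
      then show "z ^ (2 * (j - d div 2) + 1) = 1" using j d by simp
    qed auto
  qed simp
  then have "(\<Sum>j<N. of_bool (z ^ (j + 1) = 1)) \<le> (\<Sum>j<N. of_bool (z ^ (2 * j + 1) = 1) :: int)"
    by (simp add: sum_of_bool_eq Int_def Collect_conj_eq lessThan_def flip: Collect_conj_eq)
  then show ?thesis unfolding even_ind odd_ind .
qed


lemma jackson_value_order_ge: "ord_at z (jackson_value N) \<ge> ind z (4 * int N + 1)"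
  unfolding ord_at_jackson_value using sum_ind_odd_ge_even[of N] by simp

lemma order_weighted_term_ge:
  assumes "i < n"
  shows "ord_ge z (3 - 2 * ind z (4 * int i + 1)) (weight n i * jackson_value i)"
  using ord_at_weight[OF assms] jackson_value_order_ge[of i] weight_nonzero
  by (simp add: ord_ge_def ord_at_mult)

text \<open>
  Congruence modulo each factor of \<open>[n]\<close>: both sides vanish at \<open>z\<close>.
\<close>

lemma ord_ge_1_difference: "ord_ge z 1 ((\<Sum>i<n. weight n i * jackson_value i) - rhs_value n)"
proof (rule ord_ge_diff)
  show "ord_ge z 1 (\<Sum>i<n. weight n i * jackson_value i)"
  proof (rule ord_ge_sum)
    fix i assume "i \<in> {..<n}"
    moreover have "1 \<le> 3 - 2 * ind z (4 * int i + 1)"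
      using ind_cases[of z "4 * int i + 1"] by auto
    ultimately show "ord_ge z 1 (weight n i * jackson_value i)"
      by (intro ord_ge_mono[OF order_weighted_term_ge]) auto
  qed
  show "ord_ge z 1 (rhs_value n)"
  proof (cases "n mod 4 = 1")
    case True
    then have "4 * int ((n - 1) div 4) + 1 = int n" using n_pos by presburger
    moreover have "ind z (int n) = 1" using root by (simp add: ind_def)
    ultimately show ?thesis
      using jackson_value_order_ge[of "(n - 1) div 4"] True by (simp add: rhs_value_def ord_ge_def)
  qed (simp add: rhs_value_def)
qed

context
  assumes primitive: "\<And>j. z ^ j = 1 \<Longrightarrow> n dvd j"
begin

lemma ind_primitive: "ind z e = of_bool (int n dvd e)"
proof -
  have "z powi e = 1 \<longleftrightarrow> int n dvd e"
  proof
    assume "z powi e = 1"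
    then have "ind z (e mod int n) = 1" by (simp add: ind_mod) (simp add: ind_def)
    then have "z powi (e mod int n) = 1" by (simp add: ind_def)
    then have "z ^ nat (e mod int n) = 1" using n_pos by (simp add: power_int_def)
    then have "int n dvd int (nat (e mod int n))" unfolding int_dvd_int_iff by (rule primitive)
    then have "int n dvd e mod int n" using n_pos by simp
    then show "int n dvd e" by (simp add: dvd_mod_iff)
  next
    assume "int n dvd e"
    then show "z powi e = 1" using root by (auto simp: power_int_mult)
  qed
  then show ?thesis by (simp add: ind_def)
qed

text \<open>
  At a primitive root of unity only one of the nodes collides with the evaluation point.
\<close>

lemma node_index_unique:
  assumes "int n dvd 4 * int i + 1" "int n dvd 4 * int j + 1" "i < n" "j < n"
  shows "i = j"
proof -
  have "int n dvd (4 * int i + 1) - (4 * int j + 1)" using assms(1,2) by (rule dvd_diff)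
  then have "int n dvd 4 * (int i - int j)" by (simp add: algebra_simps)
  then have "int n dvd int i - int j"
    unfolding dvd_4_mult_iff .
  then show "i = j"
    using assms(3,4) dvd_imp_le_int[of "int i - int j" "int n"] by (cases "i = j") auto
qed

lemma not_dvd_4_mult_add_4:
  assumes "j + 1 < n"
  shows "\<not> int n dvd 4 * int j + 4"
proof
  assume "int n dvd 4 * int j + 4"
  then have "int n dvd 4 * int (j + 1)" by (simp add: algebra_simps)
  then have "n dvd j + 1" unfolding dvd_4_mult_iff int_dvd_int_iff .
  then show False using assms dvd_imp_le[of n "j + 1"] by simp
qed

text \<open>
  If \<open>z^(4i+1) = 1\<close>, then \<open>X_0 - X_i\<close> is \<open>(1 - q^(4i+1))^2\<close> up to a unit and vanishes to second order
  at \<open>z\<close>.  Replacing \<open>X_i\<close> by \<open>X_0\<close> turns each quotient in the weight into 1, and the denominators of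
  the quotients do not vanish at the primitive root \<open>z\<close>.
\<close>

lemma weight_near_1:
  assumes "i < n" "int n dvd 4 * int i + 1"
  shows "ord_ge z 2 (weight n i - 1)"
proof -
  let ?x = "\<lambda>j. node (4 * int j + 1)"
  have diff_0: "ord_ge z 2 (node 0 - ?x i)" "ord_ge z 2 (?x i - node 0)"
  proof -
    have "ord_at z (node 0 - ?x i) = ind z (4 * int i + 1) + ind z (- (4 * int i + 1))"
      by (subst ord_at_node_diff) (simp_all; presburger)+
    then show "ord_ge z 2 (node 0 - ?x i)"
      using assms(2) unfolding ind_uminus by (simp add: ord_ge_def ind_primitive)
    then show "ord_ge z 2 (?x i - node 0)"
      using ord_ge_uminus[of z 2 "node 0 - ?x i"] by simp
  qed
  have "ord_ge z 2 ((node 0 - ?x j) / (?x i - ?x j) - 1)" if j: "j \<in> {..<n} - {i}" for j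
  proof -
    have nz: "?x i - ?x j \<noteq> 0" using j by (intro weight_factors_nonzero) auto
    have "\<not> int n dvd 4 * int j + 1"
      using node_index_unique[OF assms(2) _ assms(1), of j] j by auto
    then have "\<not> int n dvd (4 * int i + 1) + (4 * int j + 1)" "\<not> int n dvd (4 * int i + 1) - (4 * int j + 1)"
      using assms(2) by (simp_all only: dvd_add_right_iff dvd_diff_right_iff not_False_eq_True)
    then have "ord_at z (?x i - ?x j) = 0"
      using j by (subst ord_at_node_diff) (auto simp: ind_primitive)
    then have "ord_ge z (2 + 0) ((node 0 - ?x i) * (1 / (?x i - ?x j)))"
      using nz by (intro ord_ge_mult diff_0) (simp add: ord_ge_def ord_at_divide)
    moreover have "(node 0 - ?x i) * (1 / (?x i - ?x j)) = (node 0 - ?x j) / (?x i - ?x j) - 1"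
      using nz by (simp add: field_simps)
    ultimately show ?thesis by simp
  qed
  then have 1: "ord_ge z 2 ((\<Prod>j\<in>{..<n} - {i}. (node 0 - ?x j) / (?x i - ?x j)) - 1)"
    by (rule ord_ge_prod_diff_1) simp_all
  let ?l = "\<lambda>j. lin (4 * int j + 4)"
  have "ord_ge z 2 (poly (?l j) (?x i) / poly (?l j) (node 0) - 1)" if j: "j \<in> {..<n-1}" for j
  proof -
    have nz: "poly (?l j) (node 0) \<noteq> 0" by (rule weight_factors_nonzero)
    have "\<not> int n dvd 4 * int j + 4"
      using j by (intro not_dvd_4_mult_add_4) simp
    then have "ord_at z (poly (?l j) (node 0)) = 0"
      by (subst ord_at_lin_node) (auto simp: ind_primitive)
    moreover have "ord_ge z 0 (- (q powi (4 * int j + 4)))"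
      using z_neq_0 by (simp add: ord_ge_def ord_at_uminus ord_at_power_int ord_at_q)
    ultimately have "ord_ge z (2 + (0 + 0)) ((?x i - node 0) * (- (q powi (4 * int j + 4)) * (1 / poly (?l j) (node 0))))"
      using nz by (intro ord_ge_mult diff_0) (simp_all add: ord_ge_def ord_at_divide)
    moreover have "poly (?l j) (?x i) - poly (?l j) (node 0) = (?x i - node 0) * (- (q powi (4 * int j + 4)))"
      by (simp add: lin_def algebra_simps)
    then have "(?x i - node 0) * (- (q powi (4 * int j + 4)) * (1 / poly (?l j) (node 0)))
        = (poly (?l j) (?x i) - poly (?l j) (node 0)) / poly (?l j) (node 0)"
      by simp
    then have "(?x i - node 0) * (- (q powi (4 * int j + 4)) * (1 / poly (?l j) (node 0)))
        = poly (?l j) (?x i) / poly (?l j) (node 0) - 1"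
      using nz by (simp add: diff_divide_distrib)
    ultimately show ?thesis by (simp only: add_0_right)
  qed
  then have 2: "ord_ge z 2 ((\<Prod>j<n-1. poly (?l j) (?x i) / poly (?l j) (node 0)) - 1)"
    by (rule ord_ge_prod_diff_1) simp_all
  show ?thesis
    unfolding weight_def using 1 2 by (rule ord_ge_mult_diff_1) simp
qed

text \<open>
  All terms but the exceptional one have order 3 by the count of factors.  The exceptional one is compared
  with the right-hand side: for \<open>n mod 4 = 1\<close> through \<open>weight_near_1\<close>, for \<open>n mod 4 = 3\<close> through the
  double zero coming from \<open>1 - q^(2n)\<close>.
\<close>

lemma ord_ge_3_difference: "ord_ge z 3 ((\<Sum>i<n. weight n i * jackson_value i) - rhs_value n)"
proof -
  define k where "k = (if n mod 4 = 1 then (n - 1) div 4 else (3 * n - 1) div 4)"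
  have "n mod 4 = 1 \<or> n mod 4 = 3" using odd_n by presburger
  then have k: "4 * int k + 1 = (if n mod 4 = 1 then int n else 3 * int n)" and k_less: "k < n"
    using n_pos unfolding k_def by (auto simp: split: if_splits) presburger+
  have dvd_k: "int n dvd 4 * int k + 1" unfolding k by simp
  have "ord_ge z 3 (weight n i * jackson_value i)" if i: "i \<in> {..<n} - {k}" for i
  proof -
    have "ind z (4 * int i + 1) = 0"
      using i node_index_unique[OF _ dvd_k _ k_less, of i] by (auto simp: ind_primitive)
    then show ?thesis using order_weighted_term_ge[of i] i by simp
  qed
  then have "ord_ge z 3 (\<Sum>i\<in>{..<n} - {k}. weight n i * jackson_value i)"
    by (rule ord_ge_sum)
  moreover have "ord_ge z 3 (weight n k * jackson_value k - rhs_value n)"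
  proof (cases "n mod 4 = 1")
    case True
    then have "weight n k * jackson_value k - rhs_value n = (weight n k - 1) * jackson_value k"
      by (simp add: rhs_value_def k_def algebra_simps)
    moreover have "ord_ge z (2 + 1) \<dots>"
      using weight_near_1[OF k_less dvd_k] jackson_value_order_ge[of k] dvd_k
      by (intro ord_ge_mult) (simp_all add: ord_ge_def ind_primitive)
    ultimately show ?thesis by simp
  next
    case False
    have "ind z (4 * int j + 4) = 0" if "j < k" for j
      using not_dvd_4_mult_add_4[of j] that k_less by (simp add: ind_primitive)
    then have "(\<Sum>j<k. ind z (4 * int j + 4)) = 0" by simp
    \<comment> \<open>The factor with exponent 2n lies in the product because (n - 1)/2 < k when 4k + 1 = 3n.\<close>
    moreover have "(\<Sum>j\<in>{(n - 1) div 2}. ind z (4 * int j + 2)) \<le> (\<Sum>j<k. ind z (4 * int j + 2))"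
    proof (rule sum_mono2)
      have "n \<noteq> 1" using False by auto
      then show "{(n - 1) div 2} \<subseteq> {..<k}" using False n_pos odd_n k by auto
    qed (auto simp: ind_def)
    moreover have "4 * int ((n - 1) div 2) + 2 = 2 * int n" using odd_n n_pos by presburger
    ultimately have "ord_at z (jackson_value k) \<ge> 3"
      using dvd_k by (simp add: ord_at_jackson_value ind_primitive)
    then show ?thesis
      using ord_at_weight[OF k_less] dvd_k False weight_nonzero
      by (simp add: rhs_value_def ord_ge_def ord_at_mult ind_primitive)
  qed
  moreover have "(\<Sum>i<n. weight n i * jackson_value i) - rhs_value n =
      (\<Sum>i\<in>{..<n} - {k}. weight n i * jackson_value i) + (weight n k * jackson_value k - rhs_value n)"
    using k_less by (subst sum.remove[of "{..<n}" k]) (simp_all add: algebra_simps)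
  ultimately show ?thesis by (simp only: ord_ge_add)
qed

end

end


section \<open>The modulus\<close>

lemma order_prod_linear_le:
  fixes a :: "'b \<Rightarrow> complex"
  assumes "finite I" "inj_on a I"
  shows "order z (\<Prod>i\<in>I. [:- a i, 1:]) \<le> of_bool (z \<in> a ` I)"
  using assms
proof (induction I rule: finite_induct)
  case (insert i I)
  have "order z [:- a i, 1:] = of_bool (z = a i)"
    using order_power_n_n[of "a i" 1] by (auto simp: order_0I)
  moreover have "(\<Prod>i\<in>I. [:- a i, 1:]) \<noteq> 0"
    using insert.hyps by simp
  ultimately show ?case
    using insert by (auto simp: order_mult simp del: mult_pCons_left)
qed simp

text \<open>
  The factors of the cyclotomic polynomial are distinct and belong to primitive roots of unity, so its square
  adds at most two to the multiplicity required at these points.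
\<close>

lemma cyclotomic_order_le: "order z (cyclotomic n) \<le> 1"
  and cyclotomic_root_primitive: "poly (cyclotomic n) z = 0 \<Longrightarrow> z ^ j = 1 \<longleftrightarrow> n dvd j"
  and cyclotomic_neq_0: "cyclotomic n \<noteq> 0"
proof -
  let ?K = "{k. 1 \<le> k \<and> k \<le> n \<and> gcd n k = 1}"
  let ?a = "\<lambda>k. exp (2 * complex_of_real pi * \<i> * of_nat k / of_nat n)"
  have fin: "finite ?K" by (rule finite_subset[of _ "{..n}"]) auto
  show "cyclotomic n \<noteq> 0" using fin by (simp add: cyclotomic_def)
  have "inj_on ?a ?K"
  proof (rule inj_onI)
    fix k l assume kl: "k \<in> ?K" "l \<in> ?K" "?a k = ?a l"
    then have "k mod n = l mod n" using complex_root_unity_eq[of n k l] by auto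
    then show "k = l" using kl by (cases "k = n"; cases "l = n") auto
  qed
  then have "order z (cyclotomic n) \<le> of_bool (z \<in> ?a ` ?K)"
    unfolding cyclotomic_def using fin by (intro order_prod_linear_le)
  then show "order z (cyclotomic n) \<le> 1" by (rule order_trans) simp
  assume "poly (cyclotomic n) z = 0"
  then obtain k where k: "1 \<le> k" "k \<le> n" "gcd n k = 1" "z = ?a k"
    using fin by (auto simp: cyclotomic_def poly_prod)
  have "z ^ j = ?a (k * j)"
    unfolding k(4) exp_of_nat_mult[symmetric] by (simp add: algebra_simps)
  then have "z ^ j = 1 \<longleftrightarrow> n dvd k * j"
    using complex_root_unity_eq_1[of n "k * j"] k by simp
  also have "\<dots> \<longleftrightarrow> n dvd j"
    using k(3) by (simp add: coprime_dvd_mult_right_iff coprime_iff_gcd_eq_1)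
  finally show "z ^ j = 1 \<longleftrightarrow> n dvd j" .
qed

definition qint_poly :: "nat \<Rightarrow> complex poly" where
  "qint_poly n = (\<Sum>j<n. monom 1 j)"

lemma qint_eq: "qint (int n) = omq (int n) / omq 1"
  by (simp add: qint_def omq_def)

lemma qint_eq_to_fract: "qint (int n) = to_fract (qint_poly n)"
proof -
  have "(1 - q) * (\<Sum>j<n. q ^ j) = 1 - q ^ n" by (rule one_diff_power_eq[symmetric])
  moreover have "1 - q \<noteq> 0" using omq_neq_0[of 1] by (simp add: omq_def)
  ultimately show ?thesis
    by (simp add: qint_def qint_poly_def q_power field_simps)
qed

lemma qint_poly_mult: "(1 - monom 1 1) * qint_poly n = 1 - monom 1 n"
proof -
  have "to_fract ((1 - monom 1 1) * qint_poly n) = to_fract (1 - monom 1 n)"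
    using one_diff_power_eq[of q n] by (simp add: qint_poly_def flip: q_power)
  then show ?thesis unfolding to_fract_eq_iff .
qed

lemma qint_poly_neq_0: "n > 0 \<Longrightarrow> qint_poly n \<noteq> 0"
  using qint_poly_mult[of n] by (metis monom_eq_1_iff eq_iff_diff_eq_0 less_numeral_extra(3) mult_zero_right)

lemma qint_poly_order_le:
  assumes "n > 0"
  shows "order z (qint_poly n) \<le> 1"
proof -
  have "1 - monom 1 n \<noteq> (0 :: complex poly)"
    using assms by (metis monom_eq_1_iff eq_iff_diff_eq_0 less_numeral_extra(3))
  moreover have "qint_poly n dvd 1 - monom 1 n"
    by (metis qint_poly_mult dvd_triv_right)
  ultimately have "order z (qint_poly n) \<le> order z (1 - monom 1 n)"
    by (rule dvd_imp_order_le)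
  also have "\<dots> \<le> 1" using assms by (simp add: order_one_minus_monom)
  finally show ?thesis .
qed

lemma qint_poly_root:
  assumes "poly (qint_poly n) z = 0" "n > 0"
  shows "z ^ n = 1" "z \<noteq> 1"
proof -
  have "poly ((1 - monom 1 1) * qint_poly n) z = 0" using assms by simp
  then show "z ^ n = 1" unfolding qint_poly_mult by (simp add: poly_monom)
  have "poly (qint_poly n) 1 = of_nat n" by (simp add: qint_poly_def poly_sum poly_monom)
  then show "z \<noteq> 1" using assms by auto
qed

section \<open>The supercongruence\<close>

lemma qpoch_omq:
  shows "qpoch q (q ^ 4) k = (\<Prod>j<k. omq (4 * int j + 1))"
    and "qpoch (q ^ 2) (q ^ 4) k = (\<Prod>j<k. omq (4 * int j + 2))"
    and "qpoch (q ^ 4) (q ^ 4) k = (\<Prod>j<k. omq (4 * int j + 4))"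
    and "qpoch (q ^ 2) (q ^ 2) (2 * k) = (\<Prod>j<k. omq (4 * int j + 2) * omq (4 * int j + 4))"
    and "qpoch q (q ^ 2) (2 * k) = (\<Prod>j<k. omq (4 * int j + 1) * omq (4 * int j + 3))"
proof -
  have omq: "omq (int a * int j + int b) = 1 - q ^ b * (q ^ a) ^ j" for a b j
  proof -
    have "int a * int j + int b = int (a * j + b)" by simp
    then have "omq (int a * int j + int b) = 1 - q ^ (a * j + b)"
      unfolding omq_def power_int_of_nat by (simp only: power_int_of_nat)
    then show ?thesis by (simp add: power_add power_mult mult.commute)
  qed
  show "qpoch q (q ^ 4) k = (\<Prod>j<k. omq (4 * int j + 1))"
    using omq[of 4 _ 1] by (simp add: qpoch_def)
  show "qpoch (q ^ 2) (q ^ 4) k = (\<Prod>j<k. omq (4 * int j + 2))"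
    using omq[of 4 _ 2] by (simp add: qpoch_def)
  show "qpoch (q ^ 4) (q ^ 4) k = (\<Prod>j<k. omq (4 * int j + 4))"
    using omq[of 4 _ 4] by (simp add: qpoch_def)
  have split: "(\<Prod>j<2 * k. f j) = (\<Prod>j<k. f (2 * j) * f (2 * j + 1))" for f :: "nat \<Rightarrow> ratfun"
    by (induction k) (simp_all add: mult.assoc)
  have pow: "(q ^ 2) ^ (2 * j) = (q ^ 4) ^ j" "(q ^ 2) ^ (2 * j + 1) = q ^ 2 * (q ^ 4) ^ j" for j
    by (simp_all add: power_add flip: power_mult)
  have mult: "q ^ 2 * q ^ 2 = q ^ 4" "q * q ^ 2 = q ^ 3"
    by (simp_all add: eval_nat_numeral)
  show "qpoch (q ^ 2) (q ^ 2) (2 * k) = (\<Prod>j<k. omq (4 * int j + 2) * omq (4 * int j + 4))"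
    and "qpoch q (q ^ 2) (2 * k) = (\<Prod>j<k. omq (4 * int j + 1) * omq (4 * int j + 3))"
    using omq[of 4 _ 1] omq[of 4 _ 2] omq[of 4 _ 3] omq[of 4 _ 4]
    unfolding qpoch_def split pow mult.assoc[symmetric] mult by simp_all
qed

lemma summand_eq:
  "qint (8 * int k + 1) * (qpoch q (q^4) k ^ 6 * qpoch (q^2) (q^2) (2 * k))
        / (qpoch (q^4) (q^4) k ^ 6 * qpoch q (q^2) (2 * k)) * q ^ (4 * k) = coef k * wp_ratio 0 k"
proof -
  have "(qpoch q (q^4) k ^ 6 * qpoch (q^2) (q^2) (2 * k)) / (qpoch (q^4) (q^4) k ^ 6 * qpoch q (q^2) (2 * k)) =
    (\<Prod>j<k. omq (4 * int j + 1) ^ 6 * (omq (4 * int j + 2) * omq (4 * int j + 4)) /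
       (omq (4 * int j + 4) ^ 6 * (omq (4 * int j + 1) * omq (4 * int j + 3))))"
    unfolding qpoch_omq by (simp add: prod_dividef prod.distrib prod_power_distrib)
  also have "\<dots> = (\<Prod>j<k. omq (4 * int j + 1) ^ 3 * omq (4 * int j + 2) /
             (omq (4 * int j + 4) ^ 3 * omq (4 * int j + 3)) * 
             (omq (4 * int j + 1) * omq (4 * int j + 1) / (omq (4 * int j + 4) * omq (4 * int j + 4))))"
  proof (intro prod.cong refl)
    fix j :: nat
    have "a ^ 6 * (b * c) / (c ^ 6 * (a * d)) = a ^ 3 * b / (c ^ 3 * d) * (a * a / (c * c))"
      if "a \<noteq> 0" "c \<noteq> 0" for a b c d :: ratfun
      using that by (simp add: field_simps eval_nat_numeral)
    moreover have "omq (4 * int j + 1) \<noteq> 0" "omq (4 * int j + 4) \<noteq> 0" by (simp_all; presburger)+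
    ultimately show "omq (4 * int j + 1) ^ 6 * (omq (4 * int j + 2) * omq (4 * int j + 4)) /
       (omq (4 * int j + 4) ^ 6 * (omq (4 * int j + 1) * omq (4 * int j + 3))) =
       omq (4 * int j + 1) ^ 3 * omq (4 * int j + 2) /
             (omq (4 * int j + 4) ^ 3 * omq (4 * int j + 3)) * 
             (omq (4 * int j + 1) * omq (4 * int j + 1) / (omq (4 * int j + 4) * omq (4 * int j + 4)))"
      by blast
  qed
  finally have "(qpoch q (q^4) k ^ 6 * qpoch (q^2) (q^2) (2 * k)) / (qpoch (q^4) (q^4) k ^ 6 * qpoch q (q^2) (2 * k))
     = (\<Prod>j<k. omq (4 * int j + 1) ^ 3 * omq (4 * int j + 2) /
             (omq (4 * int j + 4) ^ 3 * omq (4 * int j + 3))) * wp_ratio 0 k"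
    unfolding wp_ratio_def prod.distrib by simp
  moreover have "qint (8 * int k + 1) = omq (8 * int k + 1) / omq 1"
    by (simp add: qint_def omq_def)
  moreover have "a * x / y * b = a' * b * c * w" if "x / y = c * w" "a = a'" for a a' b c w x y :: ratfun
  proof -
    have "a * x / y * b = a * b * (x / y)" by simp
    then show ?thesis using that by simp
  qed
  ultimately show ?thesis unfolding coef_def by blast
qed

lemma jackson_value_eq:
  assumes "n mod 4 = 1"
  shows "jackson_value ((n - 1) div 4) =
    qint (int n) * (qpoch (q^2) (q^4) ((n - 1) div 4) ^ 2 / qpoch (q^4) (q^4) ((n - 1) div 4) ^ 2)"
proof -
  have "4 * int ((n - 1) div 4) + 1 = int n" using assms by presburger
  then show ?thesis
    by (simp add: jackson_value_def qint_eq qpoch_omq prod_dividef prod_power_distrib)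
qed

theorem theorem1p1:
  fixes n :: nat
  assumes "n > 0" and "odd n"
  shows "qcong
    (\<Sum>k=0..n-1. qint (8 * int k + 1)
        * (qpoch q (q^4) k ^ 6 * qpoch (q^2) (q^2) (2 * k))
        / (qpoch (q^4) (q^4) k ^ 6 * qpoch q (q^2) (2 * k))
        * q ^ (4 * k))
    (if n mod 4 = 1
     then qint (int n) * (qpoch (q^2) (q^4) ((n - 1) div 4) ^ 2
                          / qpoch (q^4) (q^4) ((n - 1) div 4) ^ 2)
     else 0)
    (qint (int n) * to_fract (cyclotomic n) ^ 2)" (is "qcong ?S ?R _")
proof -
  define P where "P = qint_poly n * cyclotomic n ^ 2"
  have "{0..n-1} = {..<n}" using assms by auto
  then have S: "?S = (\<Sum>i<n. weight n i * jackson_value i)"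
    unfolding summand_eq using sum_eq_weighted_jackson_values[OF assms(1)] by simp
  have R: "?R = rhs_value n"
    using jackson_value_eq[of n] by (cases "n mod 4 = 1") (simp_all only: rhs_value_def if_True if_False)
  have P: "qint (int n) * to_fract (cyclotomic n) ^ 2 = to_fract P"
    by (simp add: P_def qint_eq_to_fract power2_eq_square)
  have "P dvd fst (quot_of_fract (?S - ?R))"
  \<comment> \<open>For n = 1 the modulus vanishes at 1, which the analysis at the roots of unity other than 1 leaves out; both sides are then equal.\<close>
  proof (cases "n = 1")
    case True
    then have "?S - ?R = 0" by (simp add: qpoch_def)
    then show ?thesis by (metis dvd_0_right fst_conv quot_of_fract_to_fract to_fract_0)
  next
    case False
    show ?thesis
    proof (rule dvd_numeratorI)
      show "P \<noteq> 0"
        using assms by (simp add: P_def qint_poly_neq_0 cyclotomic_neq_0)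
      fix z assume z: "order z P > 0"
      have ord_P: "order z P = order z (qint_poly n) + 2 * order z (cyclotomic n)"
        using assms by (simp add: P_def power2_eq_square order_mult qint_poly_neq_0 cyclotomic_neq_0)
      show "ord_ge z (int (order z P)) (?S - ?R)"
      proof (cases "poly (cyclotomic n) z = 0")
        case True
        note prim = cyclotomic_root_primitive[OF True]
        have root: "z ^ n = 1" "z \<noteq> 1" using prim[of n] prim[of 1] False by auto
        have "int (order z P) \<le> 3"
          using cyclotomic_order_le[of z n] qint_poly_order_le[OF assms(1), of z] ord_P by linarith
        moreover have "ord_ge z 3 (?S - ?R)"
          unfolding S R using ord_ge_3_difference[OF root assms(2)] prim by blast
        ultimately show ?thesis by (rule ord_ge_mono[rotated])
      next
        case False
        then have "order z (cyclotomic n) = 0" by (rule order_0I)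
        then have ord: "order z P = order z (qint_poly n)" using ord_P by simp
        then have "poly (qint_poly n) z = 0"
          using z qint_poly_neq_0[OF assms(1)] by (simp add: order_gt_0_iff)
        note root = qint_poly_root[OF this assms(1)]
        have "int (order z P) \<le> 1"
          using qint_poly_order_le[OF assms(1), of z] ord by linarith
        moreover have "ord_ge z 1 (?S - ?R)"
          unfolding S R by (rule ord_ge_1_difference[OF root assms(2)])
        ultimately show ?thesis by (rule ord_ge_mono[rotated])
      qed
    qed
  qed
  then show ?thesis unfolding qcong_def using P by blast
qed

end
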